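(* Let $n\ge 1$. Consider the graph with vertex set $B^n(T_0)$ in which two level $n$ offspring of $T_0$ are connected by an edge if and only if they are adjacent as level $n$ offspring of $T_0$. This graph is isomorphic to the graph $\mathsf{G}_n=(\mathsf{X}^n,\mathsf{E}_n)$, with an isomorphism given by the labeling map $\Phi_n:B^n(T_0)\to\mathsf{X}^n$.
   Context: Barycentric subdivision. Let $T_0$ be a nondegenerate closed triangle in the plane. For a triangle $T$ with barycenter $b$, $B(T)$ is the collection of the six closed triangles $[v,m,b]$, where $v$ is a vertex of $T$ and $m$ is the midpoint of a side of $T$ containing $v$. For a collection $C$ of triangles $B(C)=\bigcup_{c\in C}B(c)$; $B^0(T_0)=\{T_0\}$, $B^n(T_0)=B(B^{n-1}(T_0))$. Elements of $B^n(T)$ are the level $n$ offspring of $T$; elements of $B(T)$ are the children of $T$, and $T$ is their parent. Two distinct level $n$ triangles are adjacent if they share a side. Two children of $T$ are vertex adjacent if their common side joins the barycenter of $T$ to a vertex of $T$, and side adjacent if their common side joins the barycenter of $T$ to the midpoint of a side of $T$. An offspring of $T$ is special with respect to $T$ if one of its sides lies on the boundary $\partial T$ and it contains a vertex of $T$. (If $t$ is a child of $T$, exactly one child of $t$ is special with respect to $T$.) Labeling. Let $\mathsf{X}=\{0,1,2,3,4,5\}$, and let $\mathsf{X}^n$ be the set of words of length $n$ over $\mathsf{X}$. A standard labeling of the six children of a triangle is a bijection of the children with $\mathsf{X}$ such that the pairs of children labeled $\{1,2\},\{3,4\},\{5,0\}$ are side adjacent and the pairs labeled $\{0,1\},\{2,3\},\{4,5\}$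 are vertex adjacent; it is determined by the choice of any one child's label. The maps $\Phi_n:B^n(T_0)\to\mathsf{X}^n$ are defined as follows: choose an arbitrary child of $T_0$ to be labeled $0$ and let $\Phi_1$ be the resulting standard labeling. For $n\ge2$, if $t\in B^{n-1}(T_0)$ has parent $T$ and $\Phi_{n-1}(t)=x$, then the unique child of $t$ that is special with respect to $T$ is labeled $x0$, and the other children of $t$ are labeled $x1,\dots,x5$ by the standard labeling of the children of $t$ so determined. The graph $\mathsf{G}_n$. Let $\Sigma=\prod_{i=1}^\infty\mathsf{X}$ be the set of infinite words and $\mathsf{X}^*$ the set of finite words (including the empty word). Let $\sim$ be the equivalence relation on $\Sigma$ generated by the following, for $x\in\mathsf{X}^*$, $v\in\{0,5\}^{\mathbb N}$, $i,j\in\mathsf{X}$ with $j=i+1\bmod 6$: if $i$ is odd, $xi3v\sim xj3v$ and $xi4v\sim xj4v$; if $i$ is even, $xi1v\sim xj1v$ and $xi2v\sim xj2v$. In $\mathsf{G}_n$, two distinct words $u,w\in\mathsf{X}^n$ are joined by an edge if and only if there are $x,y\in\Sigma$ such that $wx\sim uy$. *)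

theory Defs
  imports "HOL-Analysis.Analysis" "HOL-Library.Stream"
begin

section \<open>Barycentric subdivision\<close>

text \<open>Triangles are closed subsets of the plane; the vertices of a nondegenerate triangle are
  recovered from the set as its extreme points.\<close>

type_synonym region = "(real^2) set"

definition nondegenerate_triangle :: "region \<Rightarrow> bool" where
  "nondegenerate_triangle T \<longleftrightarrow> (\<exists>a b c. \<not> collinear {a, b, c} \<and> T = convex hull {a, b, c})"

definition vertices :: "region \<Rightarrow> (real^2) set" where
  "vertices T = {v. v extreme_point_of T}"

definition barycenter :: "region \<Rightarrow> real^2" where
  "barycenter T = (\<Sum>v\<in>vertices T. v) /\<^sub>R 3"

definition sides :: "region \<Rightarrow> region set" where
  "sides T = {closed_segment v w | v w. v \<in> vertices T \<and> w \<in> vertices T \<and> v \<noteq> w}"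

definition children :: "region \<Rightarrow> region set" where
  "children T = {convex hull {v, midpoint v w, barycenter T} | v w.
     v \<in> vertices T \<and> w \<in> vertices T \<and> v \<noteq> w}"

definition subdivide :: "region set \<Rightarrow> region set" where
  "subdivide C = (\<Union>T\<in>C. children T)"

definition offspring :: "region \<Rightarrow> nat \<Rightarrow> region set" where
  "offspring T n = (subdivide ^^ n) {T}"

definition adjacent :: "region \<Rightarrow> region \<Rightarrow> bool" where
  "adjacent s t \<longleftrightarrow> s \<noteq> t \<and> sides s \<inter> sides t \<noteq> {}"

definition vertex_adjacent :: "region \<Rightarrow> region \<Rightarrow> region \<Rightarrow> bool" where
  "vertex_adjacent T s t \<longleftrightarrow> s \<in> children T \<and> t \<in> children T \<and> s \<noteq> t \<and>
     (\<exists>v\<in>vertices T. closed_segment (barycenter T) v \<in> sides s \<inter> sides t)"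

definition side_adjacent :: "region \<Rightarrow> region \<Rightarrow> region \<Rightarrow> bool" where
  "side_adjacent T s t \<longleftrightarrow> s \<in> children T \<and> t \<in> children T \<and> s \<noteq> t \<and>
     (\<exists>v\<in>vertices T. \<exists>w\<in>vertices T. v \<noteq> w \<and>
        closed_segment (barycenter T) (midpoint v w) \<in> sides s \<inter> sides t)"

text \<open>\<open>special T s\<close>: \<open>s\<close> is special with respect to \<open>T\<close>.\<close>

definition special :: "region \<Rightarrow> region \<Rightarrow> bool" where
  "special T s \<longleftrightarrow> (\<exists>k. s \<in> offspring T k) \<and>
     (\<exists>e\<in>sides s. e \<subseteq> frontier T) \<and> (\<exists>v\<in>vertices T. v \<in> s)"


section \<open>Labeling\<close>

definition X :: "nat set" where
  "X = {0, 1, 2, 3, 4, 5}"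

definition words :: "nat \<Rightarrow> nat list set" where
  "words n = {w. set w \<subseteq> X \<and> length w = n}"

definition standard_labeling :: "region \<Rightarrow> (region \<Rightarrow> nat) \<Rightarrow> bool" where
  "standard_labeling T l \<longleftrightarrow> bij_betw l (children T) X \<and>
     (\<forall>s\<in>children T. \<forall>t\<in>children T.
        ({l s, l t} \<in> {{1, 2}, {3, 4}, {5, 0}} \<longrightarrow> side_adjacent T s t) \<and>
        ({l s, l t} \<in> {{0, 1}, {2, 3}, {4, 5}} \<longrightarrow> vertex_adjacent T s t))"

text \<open>The standard labeling of the children of \<open>T\<close> giving the child \<open>c\<close> the label 0. It is made
  unique as a HOL function by fixing it to be \<open>undefined\<close> off the children of \<open>T\<close>.\<close>

definition labeling_from :: "region \<Rightarrow> region \<Rightarrow> region \<Rightarrow> nat" where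
  "labeling_from T c =
     (THE l. l \<in> extensional (children T) \<and> standard_labeling T l \<and> l c = 0)"

text \<open>The same set could be a child of several triangles in the plane; the parent is unique only
  among the offspring of \<open>T0\<close> of the previous level, here level \<open>n\<close>.\<close>

definition parent :: "region \<Rightarrow> nat \<Rightarrow> region \<Rightarrow> region" where
  "parent T0 n t = (THE T. T \<in> offspring T0 n \<and> t \<in> children T)"

definition special_child :: "region \<Rightarrow> region \<Rightarrow> region" where
  "special_child T t = (THE s. s \<in> children t \<and> special T s)"

text \<open>\<open>Phi T0 c n\<close> is the labeling map on level \<open>n\<close> offspring of \<open>T0\<close> when \<open>c\<close> is the child of
  \<open>T0\<close> chosen to be labeled 0. The value at level 0 only serves to make the function total.\<close>

fun Phi :: "region \<Rightarrow> region \<Rightarrow> nat \<Rightarrow> region \<Rightarrow> nat list" where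
  "Phi T0 c 0 s = []"
| "Phi T0 c (Suc 0) s = [labeling_from T0 c s]"
| "Phi T0 c (Suc (Suc n)) s =
     (let t = parent T0 (Suc n) s; T = parent T0 n t
      in Phi T0 c (Suc n) t @ [labeling_from t (special_child T t) s])"


section \<open>Graphs\<close>

text \<open>A simple graph is a pair of a vertex set and a set of two-element edges.\<close>

type_synonym 'a graph = "'a set \<times> 'a set set"

definition graph_isomorphism :: "('a \<Rightarrow> 'b) \<Rightarrow> 'a graph \<Rightarrow> 'b graph \<Rightarrow> bool" where
  "graph_isomorphism f G H \<longleftrightarrow> bij_betw f (fst G) (fst H) \<and>
     (\<forall>u\<in>fst G. \<forall>v\<in>fst G. {u, v} \<in> snd G \<longleftrightarrow> {f u, f v} \<in> snd H)"

definition offspring_graph :: "region \<Rightarrow> nat \<Rightarrow> region graph" where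
  "offspring_graph T0 n = (offspring T0 n,
     {{s, t} | s t. s \<in> offspring T0 n \<and> t \<in> offspring T0 n \<and> adjacent s t})"

abbreviation Sigma_words :: "nat stream set" where
  "Sigma_words \<equiv> streams X"

inductive sim_gen :: "nat stream \<Rightarrow> nat stream \<Rightarrow> bool" where
  odd3: "\<lbrakk>x \<in> lists X; v \<in> streams {0, 5}; i \<in> X; j = (i + 1) mod 6; odd i\<rbrakk>
    \<Longrightarrow> sim_gen (x @- i ## 3 ## v) (x @- j ## 3 ## v)"
| odd4: "\<lbrakk>x \<in> lists X; v \<in> streams {0, 5}; i \<in> X; j = (i + 1) mod 6; odd i\<rbrakk>
    \<Longrightarrow> sim_gen (x @- i ## 4 ## v) (x @- j ## 4 ## v)"
| even1: "\<lbrakk>x \<in> lists X; v \<in> streams {0, 5}; i \<in> X; j = (i + 1) mod 6; even i\<rbrakk>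
    \<Longrightarrow> sim_gen (x @- i ## 1 ## v) (x @- j ## 1 ## v)"
| even2: "\<lbrakk>x \<in> lists X; v \<in> streams {0, 5}; i \<in> X; j = (i + 1) mod 6; even i\<rbrakk>
    \<Longrightarrow> sim_gen (x @- i ## 2 ## v) (x @- j ## 2 ## v)"

text \<open>All generators relate elements of \<^term>\<open>Sigma_words\<close>, so on that set the closure below
  is the equivalence relation generated there; elsewhere it is equality.\<close>

definition sim :: "nat stream \<Rightarrow> nat stream \<Rightarrow> bool" where
  "sim = equivclp sim_gen"

definition word_graph :: "nat \<Rightarrow> nat list graph" where
  "word_graph n = (words n,
     {{u, w} | u w. u \<in> words n \<and> w \<in> words n \<and> u \<noteq> w \<and>
        (\<exists>x\<in>Sigma_words. \<exists>y\<in>Sigma_words. sim (w @- x) (u @- y))})"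

end

theory Submission
  imports Defs
begin

text \<open>Every triangle of the subdivision below the initial one is a child, so it comes with a natural
  order of its corners: first the one that is a vertex of the parent, then the one that is a
  midpoint of a side of the parent, last the barycenter of the parent. Such an ordered triangle is
  called a flag. If the corners of the initial triangle are ordered so that its child labeled 0 is
  built from the first corner and from the side of the first two, then the labeling has a uniform
  description: the child with label \<open>k\<close> of a flag is obtained by permuting the corners with a fixed
  permutation that depends on \<open>k\<close> only and then taking first corner, midpoint of the first two and
  barycenter. Hence a word \<open>w\<close> describes a triangle, the hull of \<open>descendant f w\<close>, and the labeling
  map is the inverse of this assignment (\<open>Phi_descendant\<close>).

  Passing to a child is a sorting procedure in barycentric coordinates: the child with label \<open>k\<close>
  consists of the points whose coordinates become decreasing under the permutation \<open>k\<close>. So interior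
  points determine labels, which gives injectivity (\<open>descendant_unique\<close>), and two
  different children meet along a side precisely if their permutations differ by an exchange of the
  first two places (then the side joins a midpoint to the barycenter) or of the last two (then it joins a
  vertex to the barycenter).

  For the edges, the point to follow is the midpoint of a common side of two triangles with words
  \<open>u\<close> and \<open>w\<close>. Up to the first place where the words differ both triangles lie in the same
  ancestor. There they pass into two different children, which must share a side that carries the
  point. A descendant with a side on the shared side has a word of a special form: its first letter
  is 3 or 4, respectively 1 or 2, and all others are 0 or 5, because 0 and 5 are the labels of the
  two children that keep half of the side joining the first two corners. That half depends on the
  shared side alone, so the rest of \<open>u\<close> and of \<open>w\<close> describe the same segment, and they agree
  because a segment on a given side determines its word. This proves that adjacency is the
  relation \<open>linked\<close> (\<open>adjacent_iff_linked\<close>).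

  On the side of the infinite words, the equivalence relation is much smaller than it may seem: the
  last letter outside \<open>{0, 5}\<close> fixes the place where a generator can be applied and the generator
  itself, so no word has more than one partner and all classes have at most two elements
  (\<open>sim_iff\<close>). Cutting such a pair off after \<open>n\<close> letters gives \<open>linked\<close> again
  (\<open>matched_extension_iff_linked\<close>).\<close>

section \<open>Flags and barycentric coordinates\<close>

type_synonym 'a flag = "'a \<times> 'a \<times> 'a"

fun corners :: "'a flag \<Rightarrow> 'a set" where
  "corners (p, q, r) = {p, q, r}"

definition hull_of :: "'a::real_vector flag \<Rightarrow> 'a set" where
  "hull_of f = convex hull (corners f)"

fun pt :: "'a::real_vector flag \<Rightarrow> real flag \<Rightarrow> 'a" where
  "pt (p, q, r) (a, b, c) = a *\<^sub>R p + b *\<^sub>R q + c *\<^sub>R r"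

text \<open>Combinations of the corners are evaluated at arbitrary triples; those of weight 1 are the
  barycentric coordinates.\<close>

fun weight :: "real flag \<Rightarrow> real" where
  "weight (a, b, c) = a + b + c"

text \<open>Nondegeneracy is phrased as uniqueness of barycentric coordinates, since in this form it
  passes to children at once.\<close>

definition nondeg :: "'a::real_vector flag \<Rightarrow> bool" where
  "nondeg f \<longleftrightarrow> inj_on (pt f) {\<alpha>. weight \<alpha> = 1}"

text \<open>The permutations list the corners in the order in which they are met by the chain
  vertex, side, triangle that belongs to the label. Neighbouring labels differ alternately in the
  last two and in the first two places, as the standard labeling demands.\<close>

fun arrange :: "nat \<Rightarrow> 'a flag \<Rightarrow> 'a flag" where
  "arrange k (p, q, r) =
     (if k = 0 then (p, q, r)
      else if k = 1 then (p, r, q)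
      else if k = 2 then (r, p, q)
      else if k = 3 then (r, q, p)
      else if k = 4 then (q, r, p)
      else (q, p, r))"

fun refine :: "'a::real_vector flag \<Rightarrow> 'a flag" where
  "refine (p, q, r) = (p, midpoint p q, (p + q + r) /\<^sub>R 3)"

definition child :: "nat \<Rightarrow> 'a::real_vector flag \<Rightarrow> 'a flag" where
  "child k f = refine (arrange k f)"

text \<open>The coordinates with respect to \<open>f\<close> of the point with given coordinates with respect
  to \<open>refine f\<close>; for nonnegative arguments the result is decreasing.\<close>

fun spread :: "real flag \<Rightarrow> real flag" where
  "spread (a, b, c) = (a + b / 2 + c / 3, b / 2 + c / 3, c / 3)"

lemma X_cases:
  assumes "k \<in> X"
  obtains "k = 0" | "k = 1" | "k = 2" | "k = 3" | "k = 4" | "k = 5"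
  using assms by (auto simp: X_def)

lemma surj_arrange: "\<exists>g. arrange k g = f"
proof -
  obtain p q r where f: "f = (p, q, r)" by (cases f)
  then have "arrange k (p, q, r) = f \<or> arrange k (p, r, q) = f \<or> arrange k (q, r, p) = f
     \<or> arrange k (r, q, p) = f \<or> arrange k (r, p, q) = f \<or> arrange k (q, p, r) = f"
    by auto
  then show ?thesis by blast
qed

lemma weight_arrange [simp]: "weight (arrange k \<alpha>) = weight \<alpha>"
  by (cases \<alpha>) auto

lemma weight_spread [simp]: "weight (spread \<alpha>) = weight \<alpha>"
  by (cases \<alpha>) auto

lemma spread_eq_iff: "spread \<alpha> = spread \<beta> \<longleftrightarrow> \<alpha> = \<beta>"
  by (cases \<alpha>; cases \<beta>) auto

lemma pt_refine: "pt (refine f) \<alpha> = pt f (spread \<alpha>)"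
  by (cases f; cases \<alpha>) (simp add: midpoint_def algebra_simps)

lemma pt_arrange: "pt (arrange k f) (arrange k \<alpha>) = pt f \<alpha>"
  by (cases f; cases \<alpha>) simp

text \<open>The bridge between a child and its parent: in the order belonging to \<open>k\<close>, the parent
  coordinates are the spread of the child coordinates. Everything below about positions of points
  is read off from the inequalities that this equation imposes on \<open>\<beta>\<close>.\<close>

lemma pt_child:
  obtains \<beta> where "pt (child k f) \<alpha> = pt f \<beta>" "weight \<beta> = weight \<alpha>" "arrange k \<beta> = spread \<alpha>"
proof -
  obtain \<beta> where \<beta>: "arrange k \<beta> = spread \<alpha>" using surj_arrange by blast
  moreover have "pt (child k f) \<alpha> = pt f \<beta>"
    by (metis \<beta> child_def pt_refine pt_arrange)
  moreover have "weight \<beta> = weight \<alpha>"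
    by (metis \<beta> weight_arrange weight_spread)
  ultimately show ?thesis using that by blast
qed

lemma pt_eq_iff:
  assumes "nondeg f" "weight \<alpha> = 1" "weight \<beta> = 1"
  shows "pt f \<alpha> = pt f \<beta> \<longleftrightarrow> \<alpha> = \<beta>"
  using assms by (auto simp: nondeg_def dest: inj_onD)

lemma nondeg_child:
  assumes "nondeg f"
  shows "nondeg (child k f)"
  unfolding nondeg_def
proof (rule inj_onI)
  fix \<alpha> \<beta> assume *: "\<alpha> \<in> {\<alpha>. weight \<alpha> = 1}" "\<beta> \<in> {\<alpha>. weight \<alpha> = 1}" "pt (child k f) \<alpha> = pt (child k f) \<beta>"
  obtain \<alpha>' where a: "pt (child k f) \<alpha> = pt f \<alpha>'" "weight \<alpha>' = weight \<alpha>" "arrange k \<alpha>' = spread \<alpha>"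
    by (rule pt_child)
  obtain \<beta>' where b: "pt (child k f) \<beta> = pt f \<beta>'" "weight \<beta>' = weight \<beta>" "arrange k \<beta>' = spread \<beta>"
    by (rule pt_child)
  have "\<alpha>' = \<beta>'" using assms a b * by (simp add: pt_eq_iff)
  then show "\<alpha> = \<beta>" using a(3) b(3) by (metis spread_eq_iff)
qed

lemma nondeg_imp_not_collinear:
  assumes "nondeg f"
  shows "\<not> collinear (corners f)"
proof
  obtain p q r where f: "f = (p, q, r)" by (cases f)
  assume "collinear (corners f)"
  then consider "p = r" | u where "q = u *\<^sub>R p + (1 - u) *\<^sub>R r"
    by (auto simp: f collinear_3_expand)
  then show False
  proof cases
    case 1
    then have "pt f (1, 0, 0) = pt f (0, 0, 1)" by (simp add: f)
    then show False using assms by (simp add: pt_eq_iff)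
  next
    case 2
    then have "pt f (0, 1, 0) = pt f (u, 0, 1 - u)" by (simp add: f)
    then show False using assms by (simp add: pt_eq_iff)
  qed
qed

lemma collinear_if_combination:
  fixes p q r :: "'a::real_vector"
  assumes "a *\<^sub>R p + b *\<^sub>R q + c *\<^sub>R r = 0" "a + b + c = 0" "b \<noteq> 0"
  shows "collinear {p, q, r}"
proof -
  have c: "c = - a - b" using assms(2) by simp
  have "b *\<^sub>R q - ((- a) *\<^sub>R p + (a + b) *\<^sub>R r) = a *\<^sub>R p + b *\<^sub>R q + c *\<^sub>R r"
    unfolding c by (simp add: algebra_simps)
  then have "b *\<^sub>R q = (- a) *\<^sub>R p + (a + b) *\<^sub>R r"
    using assms(1) by simp
  then have "(1 / b) *\<^sub>R (b *\<^sub>R q) = (1 / b) *\<^sub>R ((- a) *\<^sub>R p + (a + b) *\<^sub>R r)"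
    by simp
  then have "q = (- a / b) *\<^sub>R p + (1 - (- a / b)) *\<^sub>R r"
    using assms(3) by (simp add: scaleR_right_distrib scaleR_right_diff_distrib add_divide_distrib add.commute)
  then show ?thesis
    unfolding collinear_3_expand by blast
qed

lemma not_collinear_imp_nondeg:
  fixes p q r :: "'a::real_vector"
  assumes "\<not> collinear {p, q, r}"
  shows "nondeg (p, q, r)"
proof -
  have "a = a' \<and> b = b' \<and> c = c'"
    if eq: "pt (p, q, r) (a, b, c) = pt (p, q, r) (a', b', c')" and w: "a + b + c = 1" "a' + b' + c' = 1"
    for a b c a' b' c'
  proof -
    have *: "(a - a') *\<^sub>R p + (b - b') *\<^sub>R q + (c - c') *\<^sub>R r = 0" "(a - a') + (b - b') + (c - c') = 0"
      using eq w by (simp_all add: algebra_simps)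
    have "b - b' = 0"
      using collinear_if_combination[OF *] assms by auto
    moreover have "a - a' = 0"
      using collinear_if_combination[of "b - b'" q "a - a'" p "c - c'" r] * assms
      by (auto simp: insert_commute algebra_simps)
    ultimately show ?thesis using w by simp
  qed
  then show ?thesis
    by (auto simp: nondeg_def inj_on_def)
qed

section \<open>Open cells of a flag\<close>

text \<open>The hull of a flag again, in the coordinate form needed for computations.\<close>

definition body :: "'a::real_vector flag \<Rightarrow> 'a set" where
  "body f = {pt f (a, b, c) | a b c. a + b + c = 1 \<and> a \<ge> 0 \<and> b \<ge> 0 \<and> c \<ge> 0}"

definition open_body :: "'a::real_vector flag \<Rightarrow> 'a set" where
  "open_body f = {pt f (a, b, c) | a b c. a + b + c = 1 \<and> a > 0 \<and> b > 0 \<and> c > 0}"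

text \<open>Face \<open>j\<close> is the side opposite to the corner with index \<open>j\<close>. Thus for a child, face 0
  joins a midpoint of the parent to the barycenter, face 1 a vertex to the barycenter, and face 2
  lies on the boundary of the parent.\<close>

fun face :: "nat \<Rightarrow> 'a flag \<Rightarrow> 'a \<times> 'a" where
  "face j (p, q, r) = (if j = 0 then (q, r) else if j = 1 then (p, r) else (p, q))"

fun open_face_coords :: "nat \<Rightarrow> real flag \<Rightarrow> bool" where
  "open_face_coords j (a, b, c) \<longleftrightarrow> a + b + c = 1 \<and>
     (if j = 0 then a = 0 \<and> b > 0 \<and> c > 0
      else if j = 1 then a > 0 \<and> b = 0 \<and> c > 0
      else a > 0 \<and> b > 0 \<and> c = 0)"

definition open_face :: "nat \<Rightarrow> 'a::real_vector flag \<Rightarrow> 'a set" where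
  "open_face j f = pt f ` {\<alpha>. open_face_coords j \<alpha>}"

text \<open>The words of descendants that can have a side on face \<open>j\<close> (with \<open>j < 3\<close>). One step into
  a child turns every face into half of a face 2, so all later letters come from the last case. The
  empty word stands for the flag itself.\<close>

fun on_side :: "nat \<Rightarrow> nat list \<Rightarrow> bool" where
  "on_side j [] \<longleftrightarrow> True"
| "on_side j (k # w) \<longleftrightarrow>
     k \<in> (if j = 0 then {3, 4} else if j = 1 then {1, 2} else {0, 5}) \<and> on_side 2 w"

text \<open>Two children whose face \<open>i\<close> is the same segment:
  side adjacent labels for \<open>i = 0\<close> and vertex adjacent labels for \<open>i = 1\<close>.\<close>

definition glued :: "nat \<Rightarrow> nat \<Rightarrow> nat \<Rightarrow> bool" where
  "glued i k l \<longleftrightarrow> i = 0 \<and> {k, l} \<in> {{1, 2}, {3, 4}, {5, 0}}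
                \<or> i = 1 \<and> {k, l} \<in> {{0, 1}, {2, 3}, {4, 5}}"

lemma body_eq_hull: "body f = hull_of f"
  by (cases f) (auto simp: body_def hull_of_def convex_hull_3)

lemma open_body_subset_body: "open_body f \<subseteq> body f"
  by (force simp: body_def open_body_def)

lemma open_face_subset_body: "open_face j f \<subseteq> body f"
  by (fastforce simp: body_def open_face_def split: if_splits)

lemma open_body_nonempty: "open_body f \<noteq> {}"
proof -
  have "pt f (1/3, 1/3, 1/3) \<in> open_body f"
    unfolding open_body_def by (intro CollectI exI conjI refl) auto
  then show ?thesis by blast
qed

lemma open_body_child_subset: "open_body (child k f) \<subseteq> open_body f"
proof
  fix x assume "x \<in> open_body (child k f)"
  then obtain a b c where x: "x = pt (child k f) (a, b, c)" and abc: "a + b + c = 1" "a > 0" "b > 0" "c > 0"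
    by (auto simp: open_body_def)
  obtain \<beta> where \<beta>: "x = pt f \<beta>" "weight \<beta> = 1" "arrange k \<beta> = spread (a, b, c)"
    using pt_child[of k f "(a, b, c)"] x abc by (metis weight.simps)
  then show "x \<in> open_body f"
    using abc by (cases \<beta>) (force simp: open_body_def split: if_splits)
qed

lemma body_child_subset: "body (child k f) \<subseteq> body f"
proof
  fix x assume "x \<in> body (child k f)"
  then obtain a b c where x: "x = pt (child k f) (a, b, c)" and abc: "a + b + c = 1" "a \<ge> 0" "b \<ge> 0" "c \<ge> 0"
    by (auto simp: body_def)
  obtain \<beta> where \<beta>: "x = pt f \<beta>" "weight \<beta> = 1" "arrange k \<beta> = spread (a, b, c)"
    using pt_child[of k f "(a, b, c)"] x abc by (metis weight.simps)
  then show "x \<in> body f"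
    using abc by (cases \<beta>) (force simp: body_def split: if_splits)
qed

lemma arrange_determines_label:
  fixes h m l h' m' l' :: real
  assumes "k \<in> X" "k' \<in> X" "arrange k \<alpha> = (h, m, l)" "arrange k' \<alpha> = (h', m', l')"
    and "h > m" "m > l" "h' \<ge> m'" "m' \<ge> l'"
  shows "k = k'"
proof -
  obtain x y z where "\<alpha> = (x, y, z)" by (cases \<alpha>)
  then show ?thesis
    using assms(3-) by (cases rule: X_cases[OF assms(1)]; cases rule: X_cases[OF assms(2)]; simp)
qed

text \<open>If the sorted coordinates have exactly one tie, only the two permutations that differ by
  exchanging the tied places sort them. The index 0 records a tie between the two largest
  coordinates, the index 1 one between the two smallest.\<close>

lemma arrange_tie:
  fixes h m l h' m' l' :: real
  assumes "k \<in> X" "k' \<in> X" "k \<noteq> k'" "arrange k \<alpha> = (h, m, l)" "arrange k' \<alpha> = (h', m', l')"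
    and "i = 0 \<and> h = m \<and> m > l \<or> i = 1 \<and> h > m \<and> m = l"
    and "j = 0 \<and> h' = m' \<and> m' > l' \<or> j = 1 \<and> h' > m' \<and> m' = l'"
  shows "i = j \<and> glued i k k'"
proof -
  obtain x y z where \<alpha>: "\<alpha> = (x, y, z)" by (cases \<alpha>)
  from assms(6,7) show ?thesis
    by (elim disjE conjE; cases rule: X_cases[OF assms(1)]; cases rule: X_cases[OF assms(2)];
        use assms(3-5) \<alpha> in \<open>simp add: glued_def doubleton_eq_iff\<close>)
qed

text \<open>Faces 0 and 1 of a child end at the barycenter of the parent and run through its
  interior; face 2 lies on a face of the parent, the one recorded by \<open>on_side\<close>.\<close>

lemma open_face_child:
  assumes "k \<in> X" "i < 3" "x \<in> open_face i (child k f)"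
  shows "x \<in> open_body f \<and> i \<noteq> 2 \<or> i = 2 \<and> (\<exists>j<3. x \<in> open_face j f \<and> on_side j [k])"
proof -
  obtain a b c where x: "x = pt (child k f) (a, b, c)" and abc: "open_face_coords i (a, b, c)"
    using assms(3) by (auto simp: open_face_def)
  then have "weight (a, b, c) = 1" by simp
  then obtain a' b' c' where \<beta>: "x = pt f (a', b', c')" "a' + b' + c' = 1" "arrange k (a', b', c') = spread (a, b, c)"
    using pt_child[of k f "(a, b, c)"] x by (metis weight.simps surj_pair)
  show ?thesis
  proof (cases "i = 2")
    case True
    \<comment> \<open>The missing corner of the parent is the one that the permutation puts last.\<close>
    define j :: nat where "j = (if k \<in> {3, 4} then 0 else if k \<in> {1, 2} then 1 else 2)"
    have o: "open_face_coords j (a', b', c')"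
      using abc \<beta>(2,3) True by (cases rule: X_cases[OF assms(1)]) (simp_all add: j_def)
    have "x \<in> open_face j f"
      unfolding open_face_def \<beta>(1) using o by blast
    moreover have "j < 3" "on_side j [k]"
      by (cases rule: X_cases[OF assms(1)]; simp add: j_def)+
    ultimately show ?thesis
      using True by blast
  next
    case False
    then have "a' > 0 \<and> b' > 0 \<and> c' > 0"
      using abc assms(2) \<beta>(3) by (cases rule: X_cases[OF assms(1)]) (auto split: if_splits)
    then show ?thesis
      using False \<beta>(1,2) by (auto simp: open_body_def)
  qed
qed

lemma open_body_disjoint_open_face:
  assumes "nondeg f"
  shows "open_body f \<inter> open_face i f = {}"
proof -
  have False if "pt f (a, b, c) = pt f (a', b', c')" "a + b + c = 1" "a > 0" "b > 0" "c > 0" "open_face_coords i (a', b', c')"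
    for a b c a' b' c'
  proof -
    have "(a, b, c) = (a', b', c')"
      using that assms by (subst pt_eq_iff[symmetric, of f]) simp_all
    then show False
      using that by (auto split: if_splits)
  qed
  then show ?thesis
    by (fastforce simp: open_body_def open_face_def)
qed

lemma open_face_cong_subset:
  assumes "face i f = face i g"
  shows "open_face i f \<subseteq> open_face i g"
proof -
  have "pt f \<alpha> = pt g \<alpha>" if "open_face_coords i \<alpha>" for \<alpha>
    using that assms by (cases f; cases g; cases \<alpha>) (auto split: if_splits)
  then show ?thesis
    by (force simp: open_face_def)
qed

lemma open_face_cong: "face i f = face i g \<Longrightarrow> open_face i f = open_face i g"
  by (metis open_face_cong_subset subset_antisym)

section \<open>Descendants of a flag\<close>

abbreviation descendant :: "'a::real_vector flag \<Rightarrow> nat list \<Rightarrow> 'a flag" where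
  "descendant f w \<equiv> fold child w f"

lemma nondeg_descendant: "nondeg f \<Longrightarrow> nondeg (descendant f w)"
  by (induction w arbitrary: f) (auto simp: nondeg_child)

lemma body_descendant_subset: "body (descendant f w) \<subseteq> body f"
proof (induction w arbitrary: f)
  case (Cons k w)
  show ?case using Cons.IH[of "child k f"] body_child_subset[of k f] by auto
qed simp

lemma open_body_descendant_subset: "open_body (descendant f w) \<subseteq> open_body f"
proof (induction w arbitrary: f)
  case (Cons k w)
  show ?case using Cons.IH[of "child k f"] open_body_child_subset[of k f] by auto
qed simp

text \<open>On the interior of a child and on its outer face only the last child coordinate may
  vanish, so the parent coordinates are strictly sorted and the label can be recovered.\<close>

lemma label_unique:
  assumes "nondeg f" "k \<in> X" "l \<in> X" "x \<in> body (child l f)"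
    and "x \<in> open_body (child k f) \<or> x \<in> open_face 2 (child k f)"
  shows "k = l"
proof -
  obtain a b c where abc: "x = pt (child k f) (a, b, c)" "weight (a, b, c) = 1" "a > 0" "b > 0"
    using assms(5) by (auto simp: open_body_def open_face_def)
  obtain \<alpha> where \<alpha>: "x = pt f \<alpha>" "weight \<alpha> = 1" "arrange k \<alpha> = spread (a, b, c)"
    using pt_child[of k f "(a, b, c)"] abc(1,2) by metis
  obtain a' b' c' where abc': "x = pt (child l f) (a', b', c')" "weight (a', b', c') = 1" "a' \<ge> 0" "b' \<ge> 0"
    using assms(4) by (auto simp: body_def)
  obtain \<alpha>' where \<alpha>': "x = pt f \<alpha>'" "weight \<alpha>' = 1" "arrange l \<alpha>' = spread (a', b', c')"
    using pt_child[of l f "(a', b', c')"] abc'(1,2) by metis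
  have "\<alpha>' = \<alpha>" using \<alpha> \<alpha>' pt_eq_iff[OF assms(1)] by metis
  show ?thesis
  proof (rule arrange_determines_label[OF assms(2,3)])
    show "arrange k \<alpha> = (a + b / 2 + c / 3, b / 2 + c / 3, c / 3)" using \<alpha>(3) by simp
    show "arrange l \<alpha> = (a' + b' / 2 + c' / 3, b' / 2 + c' / 3, c' / 3)"
      using \<alpha>'(3) \<open>\<alpha>' = \<alpha>\<close> by simp
  qed (use abc(3,4) abc'(3,4) in simp_all)
qed

text \<open>Different children cannot meet in an outer face, by \<open>label_unique\<close>. A point
  of face 0 or 1 has exactly one tie among its parent coordinates, and the kind of tie is the index
  of the face.\<close>

lemma open_faces_meet:
  assumes "nondeg f" "k \<in> X" "l \<in> X" "k \<noteq> l" "i < 3" "j < 3"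
    and "x \<in> open_face i (child k f)" "x \<in> open_face j (child l f)"
  shows "i = j \<and> glued i k l"
proof -
  have "i \<noteq> 2" "j \<noteq> 2"
    using label_unique[of f k l x] label_unique[of f l k x] assms open_face_subset_body by blast+
  obtain a b c where abc: "x = pt (child k f) (a, b, c)" "open_face_coords i (a, b, c)"
    using assms(7) by (auto simp: open_face_def)
  then have "weight (a, b, c) = 1" by simp
  then obtain \<alpha> where \<alpha>: "x = pt f \<alpha>" "weight \<alpha> = 1" "arrange k \<alpha> = spread (a, b, c)"
    using pt_child[of k f "(a, b, c)"] abc(1) by metis
  obtain a' b' c' where abc': "x = pt (child l f) (a', b', c')" "open_face_coords j (a', b', c')"
    using assms(8) by (auto simp: open_face_def)
  then have "weight (a', b', c') = 1" by simp
  then obtain \<alpha>' where \<alpha>': "x = pt f \<alpha>'" "weight \<alpha>' = 1" "arrange l \<alpha>' = spread (a', b', c')"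
    using pt_child[of l f "(a', b', c')"] abc'(1) by metis
  have "\<alpha>' = \<alpha>" using \<alpha> \<alpha>' pt_eq_iff[OF assms(1)] by metis
  show ?thesis
  proof (rule arrange_tie[OF assms(2-4)])
    show "arrange k \<alpha> = (a + b / 2 + c / 3, b / 2 + c / 3, c / 3)" using \<alpha>(3) by simp
    show "arrange l \<alpha> = (a' + b' / 2 + c' / 3, b' / 2 + c' / 3, c' / 3)"
      using \<alpha>'(3) \<open>\<alpha>' = \<alpha>\<close> by simp
  qed (use abc(2) abc'(2) \<open>i \<noteq> 2\<close> \<open>j \<noteq> 2\<close> assms(5,6) in \<open>auto split: if_splits\<close>)
qed

text \<open>The triangles of one level do not overlap: at the first difference the label is
  determined by the interior point.\<close>

lemma descendant_unique:
  assumes "nondeg f" "u \<in> lists X" "w \<in> lists X" "length u = length w"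
    and "x \<in> open_body (descendant f u)" "x \<in> body (descendant f w)"
  shows "u = w"
  using assms(4,1-3,5-)
proof (induction u w arbitrary: f rule: list_induct2)
  case (Cons k u l w)
  have "x \<in> open_body (child k f)" "x \<in> body (child l f)"
    using Cons.prems open_body_descendant_subset[of u "child k f"] body_descendant_subset[of w "child l f"]
    by auto
  then have "k = l"
    using label_unique[of f k l x] Cons.prems by auto
  then show ?case
    using Cons.IH[of "child k f"] Cons.prems nondeg_child[OF Cons.prems(1)] by auto
qed simp

lemma hull_of_descendant_inj:
  assumes "nondeg f" "u \<in> lists X" "w \<in> lists X" "length u = length w"
    and "hull_of (descendant f u) = hull_of (descendant f w)"
  shows "u = w"
proof -
  obtain x where "x \<in> open_body (descendant f u)" using open_body_nonempty by blast
  moreover from this have "x \<in> body (descendant f w)"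
    using open_body_subset_body[of "descendant f u"] assms(5) by (auto simp: body_eq_hull)
  ultimately show ?thesis using descendant_unique assms(1-4) by blast
qed

text \<open>A point on a side that once lies in the interior of an ancestor stays in the interior of
  all earlier ancestors; otherwise the word never leaves the boundary and has the form
  \<open>on_side\<close>. In the second case, after at least one step the face in question is face 2.\<close>

lemma open_face_descendant:
  assumes "w \<in> lists X" "j < 3" "x \<in> open_face j (descendant f w)"
  shows "x \<in> open_body f \<or> (\<exists>i<3. x \<in> open_face i f \<and> on_side i w \<and> j = (if w = [] then i else 2))"
  using assms
proof (induction w arbitrary: f rule: list.induct)
  case (Cons k w)
  have "x \<in> open_body (child k f) \<or>
      (\<exists>i<3. x \<in> open_face i (child k f) \<and> on_side i w \<and> j = (if w = [] then i else 2))"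
    using Cons by simp
  then show ?case
  proof (elim disjE exE conjE)
    assume "x \<in> open_body (child k f)"
    then show ?thesis using open_body_child_subset[of k f] Cons.prems by auto
  next
    fix i assume i: "i < 3" "x \<in> open_face i (child k f)" "on_side i w" "j = (if w = [] then i else 2)"
    have "k \<in> X" using Cons.prems by simp
    then consider "x \<in> open_body f" | i' where "i = 2" "i' < 3" "x \<in> open_face i' f" "on_side i' [k]"
      using open_face_child i(1,2) by blast
    then show ?thesis
    proof cases
      case 2
      have "on_side i' (k # w)" using 2(1,4) i(3) by simp
      moreover have "j = (if k # w = [] then i' else 2)" using 2(1) i(4) by simp
      ultimately show ?thesis using 2(2,3) by blast
    qed simp
  qed
qed auto

text \<open>The dyadic pieces of a side have unique words. Along a boundary point every step must
  go through an outer face, and there the label is determined by \<open>label_unique\<close>.\<close>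

lemma side_descendant_unique:
  assumes "nondeg f" "u \<in> lists X" "w \<in> lists X" "length u = length w" "j < 3" "i < 3"
    and "x \<in> open_face i f" "x \<in> open_face j (descendant f u)" "x \<in> body (descendant f w)"
  shows "u = w"
  using assms(4,1-3,5-)
proof (induction u w arbitrary: f i rule: list_induct2)
  case (Cons k u l w)
  have ni: "x \<notin> open_body f"
    using open_body_disjoint_open_face Cons.prems by blast
  then have "x \<notin> open_body (child k f)"
    using open_body_child_subset[of k f] Cons.prems by auto
  then obtain i' where i': "i' < 3" "x \<in> open_face i' (child k f)"
    using open_face_descendant[of u j x "child k f"] Cons.prems by auto
  moreover have "k \<in> X" using Cons.prems by simp
  ultimately have e: "x \<in> open_face 2 (child k f)"
    using open_face_child ni by blast
  moreover have "x \<in> body (child l f)"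
    using Cons.prems body_descendant_subset[of w "child l f"] by auto
  ultimately have "k = l"
    using label_unique[of f k l x] Cons.prems by auto
  then show ?case
    using Cons.IH[of "child k f" 2] Cons.prems nondeg_child[OF Cons.prems(1)] e by auto
qed simp

text \<open>The piece cut out by a word of the form \<open>on_side\<close> is computed from the two ends of the
  side by halving alone. This lets a word be transported across a side shared by two flags.\<close>

lemma face_descendant_cong:
  assumes "on_side i u" "i < 3" "face i f = face i g" "j = (if u = [] then i else 2)"
  shows "face j (descendant f u) = face j (descendant g u)"
  using assms
proof (induction u arbitrary: f g i)
  case (Cons k u)
  have "face 2 (child k f) = face 2 (child k g)"
    using Cons.prems by (cases f; cases g) (auto simp: child_def split: if_splits)
  then show ?case
    using Cons.IH[of 2 "child k f" "child k g"] Cons.prems by (auto split: if_splits)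
qed simp

lemma glued_less: "glued i k l \<Longrightarrow> i < 3"
  unfolding glued_def by linarith

lemma glued_face:
  assumes "glued i k l"
  shows "face i (child k f) = face i (child l f)"
  using assms by (cases f) (auto simp: glued_def child_def doubleton_eq_iff midpoint_sym add_ac)

section \<open>Adjacent descendants\<close>

text \<open>The meeting point of both graphs. It recurses on the first letters, since the descent into
  triangles and the comparison of infinite words both proceed from the front.\<close>

fun linked :: "nat list \<Rightarrow> nat list \<Rightarrow> bool" where
  "linked (k # u) (l # w) \<longleftrightarrow>
     (if k = l then linked u w else u = w \<and> (\<exists>i. glued i k l \<and> on_side i u))"
| "linked _ _ \<longleftrightarrow> False"

lemma linked_imp_common_face:
  assumes "linked u w"
  shows "\<exists>j<3. face j (descendant f u) = face j (descendant f w)"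
  using assms
proof (induction u w arbitrary: f rule: linked.induct)
  case (1 k u l w)
  show ?case
  proof (cases "k = l")
    case True
    with 1 show ?thesis by auto
  next
    case False
    then obtain i where i: "u = w" "glued i k l" "on_side i u" using 1 by auto
    have "i < 3" using glued_less[OF i(2)] .
    let ?j = "if u = [] then i else 2"
    have "face ?j (descendant (child k f) u) = face ?j (descendant (child l f) u)"
      by (rule face_descendant_cong[OF i(3) \<open>i < 3\<close> glued_face[OF i(2)] refl])
    then have "face ?j (descendant f (k # u)) = face ?j (descendant f (l # w))"
      unfolding fold_simps i(1) .
    moreover have "?j < 3" using \<open>i < 3\<close> by simp
    ultimately show ?thesis by blast
  qed
qed auto

text \<open>At the first difference of the words the point lies in two different children, hence by
  \<open>open_faces_meet\<close> on a face that they share. Both remainders then describe a piece of this face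
  around the same point, seen from its two sides.\<close>

lemma common_open_face_imp_linked:
  assumes "nondeg f" "u \<in> lists X" "w \<in> lists X" "length u = length w" "u \<noteq> w"
    and "j < 3" "j' < 3" "x \<in> open_face j (descendant f u)" "x \<in> open_face j' (descendant f w)"
  shows "linked u w"
  using assms(4,1-3,5-)
proof (induction u w arbitrary: f rule: list_induct2)
  case (Cons k u l w)
  show ?case
  proof (cases "k = l")
    case True
    then show ?thesis using Cons.IH[of "child k f"] Cons.prems nondeg_child[OF Cons.prems(1)] by simp
  next
    case False
    have X: "k \<in> X" "l \<in> X" "u \<in> lists X" "w \<in> lists X" using Cons.prems by auto
    have xb: "x \<in> body (descendant (child k f) u)" "x \<in> body (descendant (child l f) w)"
      using Cons.prems open_face_subset_body[of j "descendant (child k f) u"]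
        open_face_subset_body[of j' "descendant (child l f) w"] by auto
    then have "x \<in> body (child k f)" "x \<in> body (child l f)"
      using body_descendant_subset by blast+
    then have "x \<notin> open_body (child k f)" "x \<notin> open_body (child l f)"
      using label_unique[OF Cons.prems(1) X(1,2)] label_unique[OF Cons.prems(1) X(2,1)] False by auto
    then obtain i i' where
        i: "i < 3" "x \<in> open_face i (child k f)" "on_side i u" "j = (if u = [] then i else 2)"
      and i': "i' < 3" "x \<in> open_face i' (child l f)"
      using open_face_descendant[of u j x "child k f"] open_face_descendant[of w j' x "child l f"] Cons.prems
      by auto
    have "i = i' \<and> glued i k l"
      using open_faces_meet Cons.prems(1) X(1,2) False i(1,2) i' by metis
    then have "i = i'" and g: "glued i k l" by auto
    \<comment> \<open>Reflecting the first triangle in the shared face brings both words into the child \<open>l\<close>.\<close>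
    have "face j (descendant (child k f) u) = face j (descendant (child l f) u)"
      using face_descendant_cong[OF i(3,1) glued_face[OF g] i(4)] .
    moreover have "x \<in> open_face j (descendant (child k f) u)" using Cons.prems by simp
    ultimately have "x \<in> open_face j (descendant (child l f) u)"
      using open_face_cong by blast
    then have "u = w"
      using side_descendant_unique[OF nondeg_child[OF Cons.prems(1)] X(3,4) Cons.hyps Cons.prems(5) i'] xb(2)
      by blast
    then show ?thesis using False g i(3) by auto
  qed
qed simp

section \<open>Triangles as hulls of flags\<close>

lemma vertices_hull_of:
  fixes f :: "(real^2) flag"
  assumes "nondeg f"
  shows "vertices (hull_of f) = corners f"
proof -
  obtain p q r where f: "f = (p, q, r)" by (cases f)
  have "\<not> affine_dependent {p, q, r}"
    using nondeg_imp_not_collinear[OF assms] affine_dependent_imp_collinear_3 by (auto simp: f)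
  then show ?thesis
    by (auto simp: f hull_of_def vertices_def extreme_point_of_convex_hull_affine_independent)
qed

lemma nondeg_distinct:
  assumes "nondeg (p, q, r)"
  shows "distinct [p, q, r, midpoint p q, midpoint p r, midpoint q r, (p + q + r) /\<^sub>R 3]"
proof -
  let ?pt = "pt (p, q, r)"
  have "p = ?pt (1, 0, 0)" "q = ?pt (0, 1, 0)" "r = ?pt (0, 0, 1)"
    "midpoint p q = ?pt (1/2, 1/2, 0)" "midpoint p r = ?pt (1/2, 0, 1/2)"
    "midpoint q r = ?pt (0, 1/2, 1/2)" "(p + q + r) /\<^sub>R 3 = ?pt (1/3, 1/3, 1/3)"
    by (simp_all add: midpoint_def algebra_simps)
  moreover have "distinct [?pt (1, 0, 0), ?pt (0, 1, 0), ?pt (0, 0, 1), ?pt (1/2, 1/2, 0),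
      ?pt (1/2, 0, 1/2), ?pt (0, 1/2, 1/2), ?pt (1/3, 1/3, 1/3)]"
    by (simp add: pt_eq_iff[OF assms] del: pt.simps)
  ultimately show ?thesis by metis
qed

lemma barycenter_hull_of:
  fixes p q r :: "real^2"
  assumes "nondeg (p, q, r)"
  shows "barycenter (hull_of (p, q, r)) = (p + q + r) /\<^sub>R 3"
  using nondeg_distinct[OF assms] by (simp add: barycenter_def vertices_hull_of[OF assms] add.assoc)

lemma children_hull_of:
  fixes f :: "(real^2) flag"
  assumes "nondeg f"
  shows "children (hull_of f) = (\<lambda>k. hull_of (child k f)) ` X"
proof -
  obtain p q r where f: "f = (p, q, r)" by (cases f)
  let ?F = "\<lambda>v w. convex hull {v, midpoint v w, (p + q + r) /\<^sub>R 3}"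
  have "p \<noteq> q" "p \<noteq> r" "q \<noteq> r"
    using nondeg_distinct assms f by auto
  then have "children (hull_of f) = {?F p q, ?F p r, ?F r p, ?F r q, ?F q r, ?F q p}"
    using assms unfolding f children_def vertices_hull_of[OF assms[unfolded f]] barycenter_hull_of[OF assms[unfolded f]]
    by auto
  also have "\<dots> = (\<lambda>k. hull_of (child k f)) ` X"
    by (simp add: f X_def child_def hull_of_def add_ac)
  finally show ?thesis .
qed

lemma in_words_iff: "w \<in> words n \<longleftrightarrow> w \<in> lists X \<and> length w = n"
  by (auto simp: words_def)

lemma words_Suc: "words (Suc n) = {w @ [k] | w k. w \<in> words n \<and> k \<in> X}"
proof -
  have "\<exists>w' k. w = w' @ [k] \<and> w' \<in> words n \<and> k \<in> X" if "w \<in> words (Suc n)" for w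
    using that by (cases w rule: rev_cases) (auto simp: words_def)
  then show ?thesis by (auto simp: words_def)
qed

lemma offspring_hull_of:
  fixes f :: "(real^2) flag"
  assumes "nondeg f"
  shows "offspring (hull_of f) n = (\<lambda>w. hull_of (descendant f w)) ` words n"
proof (induction n)
  case 0
  have "words 0 = {[]}" by (auto simp: words_def)
  then show ?case by (simp add: offspring_def)
next
  case (Suc n)
  have "offspring (hull_of f) (Suc n) = (\<Union>w\<in>words n. children (hull_of (descendant f w)))"
    using Suc by (simp add: offspring_def subdivide_def)
  also have "\<dots> = (\<Union>w\<in>words n. (\<lambda>k. hull_of (descendant f (w @ [k]))) ` X)"
    using children_hull_of[OF nondeg_descendant[OF assms]] by simp
  also have "\<dots> = (\<lambda>w. hull_of (descendant f w)) ` words (Suc n)"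
    unfolding words_Suc by blast
  finally show ?case .
qed

lemma side_iff:
  fixes f :: "(real^2) flag"
  assumes "nondeg f"
  shows "closed_segment v w \<in> sides (hull_of f) \<longleftrightarrow> v \<in> corners f \<and> w \<in> corners f \<and> v \<noteq> w"
  by (auto simp: sides_def vertices_hull_of[OF assms] doubleton_eq_iff)

lemma midpoint_in_open_face:
  assumes "v \<in> corners f" "w \<in> corners f" "v \<noteq> w"
  shows "\<exists>j<3. midpoint v w \<in> open_face j f"
proof -
  obtain p q r where f: "f = (p, q, r)" by (cases f)
  have "midpoint q r = pt f (0, 1/2, 1/2)" "midpoint p r = pt f (1/2, 0, 1/2)" "midpoint p q = pt f (1/2, 1/2, 0)"
    by (simp_all add: f midpoint_def algebra_simps)
  then have m: "midpoint q r \<in> open_face 0 f" "midpoint p r \<in> open_face 1 f" "midpoint p q \<in> open_face 2 f"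
    unfolding open_face_def by (auto simp del: pt.simps intro!: imageI)
  have "midpoint v w \<in> {midpoint q r, midpoint p r, midpoint p q}"
    using assms by (auto simp: f midpoint_sym)
  then consider "midpoint v w = midpoint q r" | "midpoint v w = midpoint p r" | "midpoint v w = midpoint p q"
    by blast
  then show ?thesis
  proof cases
    case 1
    then show ?thesis using m(1) by (intro exI[of _ 0]) simp
  next
    case 2
    then show ?thesis using m(2) by (intro exI[of _ 1]) simp
  next
    case 3
    then show ?thesis using m(3) by (intro exI[of _ 2]) simp
  qed
qed

lemma face_is_side:
  fixes f :: "(real^2) flag"
  assumes "nondeg f" "face j f = (v, w)"
  shows "closed_segment v w \<in> sides (hull_of f)"
proof -
  obtain p q r where f: "f = (p, q, r)" by (cases f)
  show ?thesis
    using nondeg_distinct assms by (auto simp: side_iff f split: if_splits)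
qed

lemma linked_imp_neq: "linked u w \<Longrightarrow> u \<noteq> w"
  by (induction u w rule: linked.induct) (auto split: if_splits)

text \<open>A common side is determined by its two ends, so its midpoint is an inner point of a
  face of both triangles and \<open>common_open_face_imp_linked\<close> applies.\<close>

lemma adjacent_iff_linked:
  fixes f :: "(real^2) flag"
  assumes "nondeg f" "u \<in> words n" "w \<in> words n"
  shows "adjacent (hull_of (descendant f u)) (hull_of (descendant f w)) \<longleftrightarrow> linked u w"
proof
  let ?u = "descendant f u" and ?w = "descendant f w"
  have nd: "nondeg ?u" "nondeg ?w" using nondeg_descendant[OF assms(1)] by auto
  {
    assume "adjacent (hull_of ?u) (hull_of ?w)"
    then obtain e where ne: "hull_of ?u \<noteq> hull_of ?w" and e: "e \<in> sides (hull_of ?u)" "e \<in> sides (hull_of ?w)"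
      by (auto simp: adjacent_def)
    obtain v v' where v: "e = closed_segment v v'"
      using e(1) by (auto simp: sides_def)
    then have "\<exists>j<3. midpoint v v' \<in> open_face j ?u" "\<exists>j<3. midpoint v v' \<in> open_face j ?w"
      using e midpoint_in_open_face side_iff[OF nd(1)] side_iff[OF nd(2)] by blast+
    moreover have "u \<noteq> w" using ne by auto
    ultimately show "linked u w"
      using common_open_face_imp_linked[OF assms(1)] assms(2,3) unfolding in_words_iff by metis
  next
    assume l: "linked u w"
    then obtain j v v' where "face j ?u = (v, v')" "face j ?w = (v, v')"
      using linked_imp_common_face by (metis surj_pair)
    then have "closed_segment v v' \<in> sides (hull_of ?u) \<inter> sides (hull_of ?w)"
      using face_is_side nd by blast
    moreover have "hull_of ?u \<noteq> hull_of ?w"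
      using hull_of_descendant_inj[OF assms(1)] linked_imp_neq[OF l] assms(2,3) unfolding in_words_iff by metis
    ultimately show "adjacent (hull_of ?u) (hull_of ?w)"
      unfolding adjacent_def by blast
  }
qed

section \<open>The labeling\<close>

lemma parent_descendant:
  fixes f :: "(real^2) flag"
  assumes "nondeg f" "w \<in> words n" "k \<in> X"
  shows "parent (hull_of f) n (hull_of (descendant f (w @ [k]))) = hull_of (descendant f w)"
  unfolding parent_def
proof (rule the_equality)
  show "hull_of (descendant f w) \<in> offspring (hull_of f) n \<and>
      hull_of (descendant f (w @ [k])) \<in> children (hull_of (descendant f w))"
    using assms offspring_hull_of children_hull_of[OF nondeg_descendant] by auto
next
  fix T assume T: "T \<in> offspring (hull_of f) n \<and> hull_of (descendant f (w @ [k])) \<in> children T"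
  then obtain w' where w': "w' \<in> words n" "T = hull_of (descendant f w')"
    using offspring_hull_of[OF assms(1)] by auto
  then obtain k' where k': "k' \<in> X" "hull_of (descendant f (w @ [k])) = hull_of (descendant f (w' @ [k']))"
    using T children_hull_of[OF nondeg_descendant[OF assms(1)]] by auto
  have "w @ [k] \<in> words (Suc n)" "w' @ [k'] \<in> words (Suc n)"
    using assms w' k' by (auto simp: words_Suc)
  then have "w @ [k] = w' @ [k']"
    using hull_of_descendant_inj[OF assms(1) _ _ _ k'(2)] by (simp add: in_words_iff)
  then show "T = hull_of (descendant f w)" using w' by simp
qed

lemma hull_of_child_inj:
  assumes "nondeg f" "k \<in> X" "l \<in> X" "hull_of (child k f) = hull_of (child l f)"
  shows "k = l"
  using hull_of_descendant_inj[of f "[k]" "[l]"] assms by simp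

text \<open>On the frontier some barycentric coordinate vanishes.\<close>

lemma open_body_not_on_frontier:
  fixes f :: "(real^2) flag"
  assumes "nondeg f" "x \<in> frontier (hull_of f)"
  shows "x \<notin> open_body f"
proof
  obtain p q r where f: "f = (p, q, r)" by (cases f)
  assume "x \<in> open_body f"
  then obtain a b c where abc: "x = pt f (a, b, c)" "weight (a, b, c) = 1" "a > 0" "b > 0" "c > 0"
    by (auto simp: open_body_def)
  have "x \<in> closed_segment p q \<union> closed_segment q r \<union> closed_segment r p"
    using assms(2) frontier_of_triangle[of p q r] by (simp add: f hull_of_def)
  then obtain t where "x = pt f (1 - t, t, 0) \<or> x = pt f (0, 1 - t, t) \<or> x = pt f (t, 0, 1 - t)"
    by (auto simp: f in_segment algebra_simps)
  then show False
    using pt_eq_iff[OF assms(1) abc(2)] abc by auto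
qed

lemma closed_segment_in_frontier:
  fixes p q r :: "real^2"
  shows "closed_segment p q \<subseteq> frontier (hull_of (p, q, r))"
  using frontier_of_triangle[of p q r] by (auto simp: hull_of_def)

lemma segment_halves: "closed_segment p (midpoint p q) \<subseteq> closed_segment p q"
  by (simp add: subset_closed_segment midpoint_in_closed_segment)

lemma corner_coords:
  assumes "v \<in> corners f"
  shows "\<exists>\<alpha>\<in>{(1, 0, 0), (0, 1, 0), (0, 0, 1)}. v = pt f \<alpha>"
proof -
  obtain p q r where f: "f = (p, q, r)" by (cases f)
  have "pt f (1, 0, 0) = p" "pt f (0, 1, 0) = q" "pt f (0, 0, 1) = r" by (simp_all add: f)
  moreover have "v = p \<or> v = q \<or> v = r" using assms f by simp
  ultimately show ?thesis by blast
qed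

text \<open>A side on the boundary of the grandparent leaves only the labels 0 and 5, by
  \<open>open_face_descendant\<close>. Child 5 stays near the midpoint of the side and misses the vertices, so child
  0 is the special one.\<close>

lemma special_child_child:
  fixes f :: "(real^2) flag"
  assumes "nondeg f" "i \<in> X"
  shows "special_child (hull_of f) (hull_of (child i f)) = hull_of (child 0 (child i f))"
  unfolding special_child_def
proof (rule the_equality)
  have nd: "nondeg (child i f)" "\<And>k. nondeg (child k (child i f))"
    using assms nondeg_child by blast+
  have off: "hull_of (child k (child i f)) \<in> offspring (hull_of f) 2" if "k \<in> X" for k
    using assms that by (auto simp: offspring_hull_of in_words_iff intro!: image_eqI[of _ _ "[i, k]"])
  show "hull_of (child 0 (child i f)) \<in> children (hull_of (child i f)) \<and>
      special (hull_of f) (hull_of (child 0 (child i f)))"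
  proof
    show "hull_of (child 0 (child i f)) \<in> children (hull_of (child i f))"
      using nd by (auto simp: children_hull_of X_def)
    obtain p q r where g: "arrange i f = (p, q, r)" by (metis surj_pair)
    have c: "corners f = {p, q, r}"
      using g by (cases f) (auto split: if_splits)
    then have h: "hull_of f = hull_of (p, q, r)" by (simp add: hull_of_def)
    let ?m = "midpoint p (midpoint p q)"
    obtain z where z: "child 0 (child i f) = (p, ?m, z)"
      by (simp add: child_def g)
    have "p \<noteq> ?m" using nondeg_distinct nd(2)[of 0] z by fastforce
    then have "closed_segment p ?m \<in> sides (hull_of (child 0 (child i f)))"
      unfolding side_iff[OF nd(2)] using z by simp
    moreover have "closed_segment p ?m \<subseteq> frontier (hull_of f)"
      unfolding h using segment_halves closed_segment_in_frontier by blast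
    moreover have "p \<in> hull_of (child 0 (child i f))"
      unfolding z hull_of_def by (simp add: hull_inc)
    ultimately show "special (hull_of f) (hull_of (child 0 (child i f)))"
      unfolding special_def vertices_hull_of[OF assms(1)] c using off[of 0] by (auto simp: X_def)
  qed
  fix s assume s: "s \<in> children (hull_of (child i f)) \<and> special (hull_of f) s"
  then obtain k where k: "k \<in> X" "s = hull_of (child k (child i f))"
    using children_hull_of[OF nd(1)] by auto
  obtain e where e: "e \<in> sides s" "e \<subseteq> frontier (hull_of f)"
    using s by (auto simp: special_def)
  obtain v where v: "v \<in> corners f" "v \<in> s"
    using s by (auto simp: special_def vertices_hull_of[OF assms(1)])
  obtain a b where ab: "e = closed_segment a b" "a \<in> corners (child k (child i f))" "b \<in> corners (child k (child i f))" "a \<noteq> b"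
    using e(1) unfolding k(2) sides_def vertices_hull_of[OF nd(2)] by blast
  then obtain j where j: "j < 3" "midpoint a b \<in> open_face j (descendant f [i, k])"
    using midpoint_in_open_face[OF ab(2-4)] by auto
  have "midpoint a b \<in> frontier (hull_of f)"
    using e(2) ab(1) midpoint_in_closed_segment by blast
  then have "midpoint a b \<notin> open_body f"
    using open_body_not_on_frontier assms(1) by blast
  moreover have "[i, k] \<in> lists X" using k(1) assms(2) by simp
  ultimately obtain l where "on_side l [i, k]"
    using open_face_descendant[OF _ j] by blast
  then have "k = 0 \<or> k = 5" by simp
  moreover have "k \<noteq> 5"
  proof
    assume "k = 5"
    obtain \<alpha> where \<alpha>: "v = pt f \<alpha>" "\<alpha> \<in> {(1, 0, 0), (0, 1, 0), (0, 0, 1)}"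
      using corner_coords[OF v(1)] by blast
    then have w: "weight \<alpha> = 1" by auto
    have "v \<in> body (child k (child i f))" using v(2) by (simp add: k(2) body_eq_hull)
    then obtain a b c where abc: "v = pt (child k (child i f)) (a, b, c)" "weight (a, b, c) = 1" "a \<ge> 0" "b \<ge> 0" "c \<ge> 0"
      by (auto simp: body_def)
    obtain \<beta> where \<beta>: "v = pt (child i f) \<beta>" "weight \<beta> = 1" "arrange k \<beta> = spread (a, b, c)"
      using pt_child[of k "child i f" "(a, b, c)"] abc(1,2) by metis
    obtain \<gamma> where \<gamma>: "v = pt f \<gamma>" "weight \<gamma> = 1" "arrange i \<gamma> = spread \<beta>"
      using pt_child[of i f \<beta>] \<beta>(1,2) by metis
    have "\<gamma> = \<alpha>" using pt_eq_iff[OF assms(1) w \<gamma>(2)] \<alpha>(1) \<gamma>(1) by simp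
    obtain x y z where xyz: "\<beta> = (x, y, z)" by (cases \<beta>)
    \<comment> \<open>A vertex of \<open>f\<close> that lies in the child \<open>i\<close> is its first corner, with coordinates (1, 0, 0), but in child 5 the second coordinate is the largest.\<close>
    have "y \<ge> x" "x \<ge> z" "z \<ge> 0"
      using \<beta>(3) xyz abc(3-5) \<open>k = 5\<close> by auto
    then show False
      using \<gamma>(3) \<open>\<gamma> = \<alpha>\<close> xyz \<alpha>(2) by (auto split: if_splits)
  qed
  ultimately show "s = hull_of (child 0 (child i f))" using k(2) by simp
qed

lemma corners_arrange [simp]: "corners (arrange k f) = corners f"
  by (cases f) auto

lemma nondeg_arrange:
  assumes "nondeg f"
  shows "nondeg (arrange k f)"
proof -
  obtain p q r where g: "arrange k f = (p, q, r)" by (metis surj_pair)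
  have "corners f = {p, q, r}" using corners_arrange[of k f] g by simp
  then show ?thesis
    using not_collinear_imp_nondeg nondeg_imp_not_collinear[OF assms] g by metis
qed

lemma corner_of_child_iff:
  assumes "nondeg f" "v \<in> corners f"
  shows "v \<in> corners (child k f) \<longleftrightarrow> v = fst (child k f)"
proof -
  obtain p q r where g: "arrange k f = (p, q, r)" by (metis surj_pair)
  have "nondeg (p, q, r)" "v \<in> {p, q, r}"
    using nondeg_arrange[OF assms(1), of k] corners_arrange[of k f] g assms(2) by simp_all
  then show ?thesis
    using nondeg_distinct[of p q r] by (auto simp: child_def g)
qed

lemma midpoint_corner_of_child_iff:
  assumes "nondeg f" "v \<in> corners f" "w \<in> corners f" "v \<noteq> w"
  shows "midpoint v w \<in> corners (child k f) \<longleftrightarrow> midpoint v w = fst (snd (child k f))"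
proof -
  obtain p q r where g: "arrange k f = (p, q, r)" by (metis surj_pair)
  have nd: "nondeg (p, q, r)" and "v \<in> {p, q, r}" "w \<in> {p, q, r}"
    using nondeg_arrange[OF assms(1), of k] corners_arrange[of k f] g assms(2,3) by simp_all
  then have "midpoint v w \<in> {midpoint p q, midpoint p r, midpoint q r}"
    using assms(4) by (auto simp: midpoint_sym)
  then have "midpoint v w \<noteq> p" "midpoint v w \<noteq> (p + q + r) /\<^sub>R 3"
    using nondeg_distinct[OF nd] by auto
  then show ?thesis
    by (simp add: child_def g)
qed

text \<open>The third corner is the common barycenter, which makes faces 0 and 1 of
  children comparable with the segments in the definition of the two kinds of adjacency.\<close>

lemma child_eq_barycenter:
  fixes f :: "(real^2) flag"
  assumes "nondeg f"
  obtains v w where "v \<in> corners f" "w \<in> corners f" "v \<noteq> w"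
    "child k f = (v, midpoint v w, barycenter (hull_of f))"
proof -
  obtain p q r where g: "arrange k f = (p, q, r)" by (metis surj_pair)
  have nd: "nondeg (p, q, r)" and c: "corners f = {p, q, r}"
    using nondeg_arrange[OF assms, of k] corners_arrange[of k f] g by simp_all
  then have "hull_of f = hull_of (p, q, r)" by (simp add: hull_of_def)
  then have "child k f = (p, midpoint p q, barycenter (hull_of f))"
    using barycenter_hull_of[OF nd] by (simp add: child_def g)
  moreover have "p \<noteq> q" using nondeg_distinct[OF nd] by auto
  ultimately show ?thesis using that c by auto
qed

lemma glued_1_iff:
  assumes "nondeg f" "k \<in> X" "l \<in> X"
  shows "glued 1 k l \<longleftrightarrow> k \<noteq> l \<and> fst (child k f) = fst (child l f)"
proof -
  obtain p q r where f: "f = (p, q, r)" by (cases f)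
  have "p \<noteq> q" "p \<noteq> r" "q \<noteq> r" using nondeg_distinct assms(1) f by auto
  then show ?thesis
    by (cases rule: X_cases[OF assms(2)]; cases rule: X_cases[OF assms(3)];
        simp add: f child_def glued_def doubleton_eq_iff)
qed

lemma glued_0_iff:
  assumes "nondeg f" "k \<in> X" "l \<in> X"
  shows "glued 0 k l \<longleftrightarrow> k \<noteq> l \<and> fst (snd (child k f)) = fst (snd (child l f))"
proof -
  obtain p q r where f: "f = (p, q, r)" by (cases f)
  have "midpoint p q \<noteq> midpoint p r" "midpoint p q \<noteq> midpoint q r" "midpoint p r \<noteq> midpoint q r"
    using nondeg_distinct assms(1) f by auto
  then show ?thesis
    by (cases rule: X_cases[OF assms(2)]; cases rule: X_cases[OF assms(3)];
        simp add: f child_def glued_def doubleton_eq_iff midpoint_sym)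
qed

lemma vertex_adjacent_children:
  fixes f :: "(real^2) flag"
  assumes "nondeg f" "k \<in> X" "l \<in> X"
  shows "vertex_adjacent (hull_of f) (hull_of (child k f)) (hull_of (child l f)) \<longleftrightarrow> glued 1 k l"
proof -
  let ?b = "barycenter (hull_of f)"
  have nd: "nondeg (child j f)" for j using assms(1) by (rule nondeg_child)
  have b: "?b \<in> corners (child j f)" for j
    using child_eq_barycenter[OF assms(1), of j] by (metis corners.simps insertCI)
  have apex: "fst (child j f) \<in> corners f \<and> fst (child j f) \<noteq> ?b" for j
  proof -
    obtain v w where vw: "v \<in> corners f" "child j f = (v, midpoint v w, ?b)"
      using child_eq_barycenter[OF assms(1)] by metis
    then show ?thesis using nondeg_distinct nd[of j] by fastforce
  qed
  have seg: "closed_segment ?b v \<in> sides (hull_of (child j f)) \<longleftrightarrow> v = fst (child j f)" if "v \<in> corners f" for v j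
    using corner_of_child_iff[OF assms(1) that, of j] apex[of j] b[of j] unfolding side_iff[OF nd] by metis
  have "vertex_adjacent (hull_of f) (hull_of (child k f)) (hull_of (child l f)) \<longleftrightarrow>
      hull_of (child k f) \<noteq> hull_of (child l f) \<and> fst (child k f) = fst (child l f)"
    unfolding vertex_adjacent_def vertices_hull_of[OF assms(1)] children_hull_of[OF assms(1)]
    using seg apex assms(2,3) by auto
  also have "\<dots> \<longleftrightarrow> glued 1 k l"
    using glued_1_iff[OF assms] hull_of_child_inj[OF assms] by blast
  finally show ?thesis .
qed

lemma side_adjacent_children:
  fixes f :: "(real^2) flag"
  assumes "nondeg f" "k \<in> X" "l \<in> X"
  shows "side_adjacent (hull_of f) (hull_of (child k f)) (hull_of (child l f)) \<longleftrightarrow> glued 0 k l"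
proof -
  let ?b = "barycenter (hull_of f)" and ?m = "\<lambda>j. fst (snd (child j f))"
  have nd: "nondeg (child j f)" for j using assms(1) by (rule nondeg_child)
  have b: "?b \<in> corners (child j f)" for j
    using child_eq_barycenter[OF assms(1), of j] by (metis corners.simps insertCI)
  have mid: "\<exists>v\<in>corners f. \<exists>w\<in>corners f. v \<noteq> w \<and> ?m j = midpoint v w" "?m j \<noteq> ?b" for j
  proof -
    obtain v w where vw: "v \<in> corners f" "w \<in> corners f" "v \<noteq> w" "child j f = (v, midpoint v w, ?b)"
      using child_eq_barycenter[OF assms(1)] by metis
    then show "\<exists>v\<in>corners f. \<exists>w\<in>corners f. v \<noteq> w \<and> ?m j = midpoint v w" by auto
    show "?m j \<noteq> ?b" using nondeg_distinct nd[of j] vw(4) by fastforce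
  qed
  have seg: "closed_segment ?b (midpoint v w) \<in> sides (hull_of (child j f)) \<longleftrightarrow> midpoint v w = ?m j"
    if "v \<in> corners f" "w \<in> corners f" "v \<noteq> w" for v w j
    using midpoint_corner_of_child_iff[OF assms(1) that, of j] mid(2)[of j] b[of j]
    unfolding side_iff[OF nd] by metis
  have "side_adjacent (hull_of f) (hull_of (child k f)) (hull_of (child l f)) \<longleftrightarrow>
      hull_of (child k f) \<noteq> hull_of (child l f) \<and>
      (\<exists>v\<in>corners f. \<exists>w\<in>corners f. v \<noteq> w \<and> midpoint v w = ?m k \<and> midpoint v w = ?m l)"
    (is "_ \<longleftrightarrow> _ \<and> ?R")
  proof -
    have "(\<exists>v\<in>corners f. \<exists>w\<in>corners f. v \<noteq> w \<and> closed_segment ?b (midpoint v w)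
        \<in> sides (hull_of (child k f)) \<inter> sides (hull_of (child l f))) \<longleftrightarrow> ?R"
      by (intro bex_cong refl) (use seg in blast)
    then show ?thesis
      unfolding side_adjacent_def vertices_hull_of[OF assms(1)] children_hull_of[OF assms(1)]
      using assms(2,3) by blast
  qed
  also have "\<dots> \<longleftrightarrow> hull_of (child k f) \<noteq> hull_of (child l f) \<and> ?m k = ?m l"
    using mid(1)[of k] by metis
  also have "\<dots> \<longleftrightarrow> glued 0 k l"
    using glued_0_iff[OF assms] hull_of_child_inj[OF assms] by blast
  finally show ?thesis .
qed

lemma glued_right_unique: "glued i k l \<Longrightarrow> glued i k l' \<Longrightarrow> l = l'"
  by (auto simp: glued_def doubleton_eq_iff)

text \<open>The two kinds of adjacency become one condition with the kind \<open>i\<close> as a parameter, the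
  form in which labels are propagated around the barycenter.\<close>

lemma standard_labeling_hull_of:
  fixes f :: "(real^2) flag"
  assumes "nondeg f"
  shows "standard_labeling (hull_of f) l \<longleftrightarrow> bij_betw l (children (hull_of f)) X \<and>
    (\<forall>k\<in>X. \<forall>k'\<in>X. \<forall>i. glued i (l (hull_of (child k f))) (l (hull_of (child k' f))) \<longrightarrow> glued i k k')"
proof -
  let ?H = "\<lambda>k. hull_of (child k f)"
  have dist: "(\<forall>i. (i = 0 \<and> P \<or> i = (1::nat) \<and> Q) \<longrightarrow> R i) \<longleftrightarrow> (P \<longrightarrow> R 0) \<and> (Q \<longrightarrow> R 1)" for P Q R
    by auto
  have eq: "(\<forall>i. glued i (l (?H k)) (l (?H k')) \<longrightarrow> glued i k k') \<longleftrightarrow>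
     ({l (?H k), l (?H k')} \<in> {{1, 2}, {3, 4}, {5, 0}} \<longrightarrow> side_adjacent (hull_of f) (?H k) (?H k')) \<and>
     ({l (?H k), l (?H k')} \<in> {{0, 1}, {2, 3}, {4, 5}} \<longrightarrow> vertex_adjacent (hull_of f) (?H k) (?H k'))"
    if "k \<in> X" "k' \<in> X" for k k'
    unfolding side_adjacent_children[OF assms that] vertex_adjacent_children[OF assms that]
      glued_def[of _ "l (?H k)" "l (?H k')"] by (rule dist)
  have ball: "(\<forall>s\<in>children (hull_of f). \<forall>t\<in>children (hull_of f). Q s t) \<longleftrightarrow>
      (\<forall>k\<in>X. \<forall>k'\<in>X. Q (?H k) (?H k'))" for Q
    unfolding children_hull_of[OF assms] by blast
  show ?thesis
    unfolding standard_labeling_def ball by (intro conj_cong ball_cong refl eq[symmetric])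
qed

text \<open>Uniqueness holds because the gluing relations form the cycle 0, 1, 2, 3, 4, 5: starting
  from the child labeled 0, each next label is forced.\<close>

lemma labeling_from_child:
  fixes f :: "(real^2) flag"
  assumes "nondeg f" "k \<in> X"
  shows "labeling_from (hull_of f) (hull_of (child 0 f)) (hull_of (child k f)) = k"
proof -
  let ?H = "\<lambda>k. hull_of (child k f)"
  let ?C = "children (hull_of f)"
  have C: "?C = ?H ` X" using children_hull_of[OF assms(1)] .
  have inj: "inj_on ?H X"
    using hull_of_child_inj[OF assms(1)] by (auto intro: inj_onI)
  define l0 where "l0 = restrict (inv_into X ?H) ?C"
  have l0: "l0 (?H k) = k" if "k \<in> X" for k
    using inv_into_f_f[OF inj that] that by (simp add: l0_def C)
  have X0: "(0::nat) \<in> X" by (simp add: X_def)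
  have "labeling_from (hull_of f) (?H 0) = l0"
    unfolding labeling_from_def
  proof (rule the_equality)
    have "bij_betw l0 ?C X"
      unfolding C by (rule bij_betwI[of _ _ _ ?H]) (auto simp: l0)
    then show "l0 \<in> extensional ?C \<and> standard_labeling (hull_of f) l0 \<and> l0 (?H 0) = 0"
      unfolding standard_labeling_hull_of[OF assms(1)] using l0 X0 by (auto simp: l0_def)
  next
    fix l assume l: "l \<in> extensional ?C \<and> standard_labeling (hull_of f) l \<and> l (?H 0) = 0"
    then have bij: "bij_betw l ?C X"
      and st: "\<And>k k' i. k \<in> X \<Longrightarrow> k' \<in> X \<Longrightarrow> glued i (l (?H k)) (l (?H k')) \<Longrightarrow> glued i k k'"
      using standard_labeling_hull_of[OF assms(1)] by blast+
    have step: "l (?H j) = j" if "l (?H k) = k" "k \<in> X" "j \<in> X" "glued i k j" for i k j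
    proof -
      have "j \<in> l ` ?C" using bij that(3) by (simp add: bij_betw_def)
      then obtain j' where j': "j' \<in> X" "l (?H j') = j" using C by auto
      then have "glued i k j'" using st[of k j' i] that by simp
      then have "j' = j" using that(4) glued_right_unique by blast
      then show ?thesis using j' by simp
    qed
    have l_0: "l (?H 0) = 0" using l by simp
    have l_1: "l (?H 1) = 1" by (rule step[OF l_0, of _ 1]) (auto simp: X_def glued_def)
    have l_2: "l (?H 2) = 2" by (rule step[OF l_1, of _ 0]) (auto simp: X_def glued_def)
    have l_3: "l (?H 3) = 3" by (rule step[OF l_2, of _ 1]) (auto simp: X_def glued_def)
    have l_4: "l (?H 4) = 4" by (rule step[OF l_3, of _ 0]) (auto simp: X_def glued_def)
    have l_5: "l (?H 5) = 5" by (rule step[OF l_4, of _ 1]) (auto simp: X_def glued_def)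
    have all: "l (?H k) = k" if "k \<in> X" for k
      by (cases rule: X_cases[OF that]) (use l_0 l_1 l_2 l_3 l_4 l_5 in simp_all)
    show "l = l0"
    proof (rule extensionalityI[of _ ?C])
      show "l \<in> extensional ?C" using l by simp
      show "l0 \<in> extensional ?C" by (simp add: l0_def)
      fix s assume "s \<in> ?C"
      then show "l s = l0 s" using C all l0 by auto
    qed
  qed
  then show ?thesis using l0 assms(2) by simp
qed

text \<open>The corner order of a flag puts the special child in position 0, so every step of the
  recursion for the labeling appends the last letter of the word.\<close>

lemma Phi_descendant:
  fixes f :: "(real^2) flag"
  assumes "nondeg f" "w \<in> words (Suc n)"
  shows "Phi (hull_of f) (hull_of (child 0 f)) (Suc n) (hull_of (descendant f w)) = w"
  using assms(2)
proof (induction n arbitrary: w)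
  case 0
  then obtain k where "w = [k]" "k \<in> X"
    by (auto simp: words_def length_Suc_conv)
  then show ?case using labeling_from_child[OF assms(1)] by simp
next
  case (Suc n)
  obtain u k where u: "w = u @ [k]" "u \<in> words (Suc n)" "k \<in> X"
    using Suc.prems words_Suc[of "Suc n"] by auto
  obtain v i where v: "u = v @ [i]" "v \<in> words n" "i \<in> X"
    using u(2) words_Suc[of n] by auto
  have p: "parent (hull_of f) (Suc n) (hull_of (descendant f w)) = hull_of (descendant f u)"
    using parent_descendant[OF assms(1) u(2,3)] u(1) by simp
  have pp: "parent (hull_of f) n (hull_of (descendant f u)) = hull_of (descendant f v)"
    using parent_descendant[OF assms(1) v(2,3)] v(1) by simp
  have du: "descendant f u = child i (descendant f v)" using v(1) by simp
  have sc: "special_child (hull_of (descendant f v)) (hull_of (descendant f u)) = hull_of (child 0 (descendant f u))"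
    using special_child_child[OF nondeg_descendant[OF assms(1)] v(3)] du by simp
  have lab: "labeling_from (hull_of (descendant f u)) (hull_of (child 0 (descendant f u))) (hull_of (descendant f w)) = k"
    using labeling_from_child[OF nondeg_descendant[OF assms(1)] u(3)] u(1) by simp
  show ?case
    unfolding Phi.simps p Let_def pp sc lab Suc.IH[OF u(2)] using u(1) by simp
qed

text \<open>The first letter of the labeling is as arbitrary as the order of the corners of the
  initial triangle: permuting them by \<open>k\<close> moves child \<open>k\<close> to position 0.\<close>

lemma triangle_with_first_child:
  assumes "nondegenerate_triangle T" "c \<in> children T"
  obtains f where "nondeg f" "T = hull_of f" "c = hull_of (child 0 f)"
proof -
  obtain p q r where "\<not> collinear {p, q, r}" and T: "T = hull_of (p, q, r)"
    using assms(1) by (auto simp: nondegenerate_triangle_def hull_of_def)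
  then have nd: "nondeg (p, q, r)" by (simp add: not_collinear_imp_nondeg)
  then obtain k where k: "c = hull_of (child k (p, q, r))"
    using assms(2) children_hull_of T by auto
  let ?f = "arrange k (p, q, r)"
  have "child 0 ?f = child k (p, q, r)"
    unfolding child_def by (cases ?f) simp
  moreover have "hull_of ?f = T"
    unfolding T hull_of_def corners_arrange ..
  ultimately show ?thesis
    using that nondeg_arrange[OF nd] k by metis
qed

section \<open>The relation on infinite words\<close>

text \<open>A symmetric form of the generators, indexed by the kind of gluing. The common prefix is
  built up letter by letter, so that words can be compared from the front.\<close>

inductive matched :: "nat stream \<Rightarrow> nat stream \<Rightarrow> bool" where
  here: "\<lbrakk>glued a i j; on_side a [m]; v \<in> streams {0, 5}\<rbrakk> \<Longrightarrow> matched (i ## m ## v) (j ## m ## v)"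
| there: "\<lbrakk>k \<in> X; matched s t\<rbrakk> \<Longrightarrow> matched (k ## s) (k ## t)"

lemma matched_SConsE:
  assumes "matched (k ## s) t"
  obtains a l m v where "glued a k l" "on_side a [m]" "v \<in> streams {0, 5}" "s = m ## v" "t = l ## m ## v"
    | t' where "k \<in> X" "matched s t'" "t = k ## t'"
  using assms by (auto elim: matched.cases simp del: on_side.simps)

lemma glued_sym: "glued a i j \<longleftrightarrow> glued a j i"
  by (auto simp: glued_def insert_commute)

lemma matched_sym: "matched s t \<Longrightarrow> matched t s"
  by (induction rule: matched.induct) (blast intro: matched.intros glued_sym[THEN iffD1])+

lemma matched_shift: "x \<in> lists X \<Longrightarrow> matched s t \<Longrightarrow> matched (x @- s) (x @- t)"
  by (induction x) (auto intro: matched.there)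

lemma glued_successor:
  assumes "i \<in> X"
  shows "glued (if odd i then 0 else 1) i ((i + 1) mod 6)"
  unfolding glued_def by (cases rule: X_cases[OF assms]; simp add: doubleton_eq_iff)

lemma glued_imp_successor:
  assumes "glued a i j"
  shows "i \<in> X \<and> j = (i + 1) mod 6 \<and> a = (if odd i then 0 else 1) \<or>
         j \<in> X \<and> i = (j + 1) mod 6 \<and> a = (if odd j then 0 else 1)"
proof -
  have "(i, j) \<in> {(1, 2), (2, 1), (3, 4), (4, 3), (5, 0), (0, 5)} \<and> a = 0 \<or>
        (i, j) \<in> {(0, 1), (1, 0), (2, 3), (3, 2), (4, 5), (5, 4)} \<and> a = 1"
    using assms unfolding glued_def by (elim disjE conjE insertE; auto simp: doubleton_eq_iff)
  then show ?thesis
    by (elim disjE conjE insertE emptyE Pair_inject; simp add: X_def)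
qed

lemma sim_gen_imp_matched: "sim_gen s t \<Longrightarrow> matched s t"
proof (induction rule: sim_gen.induct)
  case (odd3 x v i j)
  then show ?case
    using glued_successor[of i] by (intro matched_shift matched.here[of 0]) simp_all
next
  case (odd4 x v i j)
  then show ?case
    using glued_successor[of i] by (intro matched_shift matched.here[of 0]) simp_all
next
  case (even1 x v i j)
  then show ?case
    using glued_successor[of i] by (intro matched_shift matched.here[of 1]) simp_all
next
  case (even2 x v i j)
  then show ?case
    using glued_successor[of i] by (intro matched_shift matched.here[of 1]) simp_all
qed

lemma sim_gen_SCons:
  assumes "sim_gen s t" "k \<in> X"
  shows "sim_gen (k ## s) (k ## t)"
  using assms
proof (induction rule: sim_gen.induct)
  case (odd3 x v i j)
  then show ?case using sim_gen.odd3[of "k # x" v i j] by simp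
next
  case (odd4 x v i j)
  then show ?case using sim_gen.odd4[of "k # x" v i j] by simp
next
  case (even1 x v i j)
  then show ?case using sim_gen.even1[of "k # x" v i j] by simp
next
  case (even2 x v i j)
  then show ?case using sim_gen.even2[of "k # x" v i j] by simp
qed

lemma sim_gen_here:
  assumes "glued a i j" "on_side a [m]" "v \<in> streams {0, 5}"
  shows "symclp sim_gen (i ## m ## v) (j ## m ## v)"
proof -
  have *: "sim_gen (i ## m ## v) (j ## m ## v)"
    if "i \<in> X" "j = (i + 1) mod 6" "a = (if odd i then 0 else 1)" for i j
  proof (cases "odd i")
    case True
    then have "m = 3 \<or> m = 4" using assms(2) that(3) by simp
    then show ?thesis
      using sim_gen.odd3[of "[]" v i j] sim_gen.odd4[of "[]" v i j] True that assms(3) by auto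
  next
    case False
    then have "m = 1 \<or> m = 2" using assms(2) that(3) by simp
    then show ?thesis
      using sim_gen.even1[of "[]" v i j] sim_gen.even2[of "[]" v i j] False that assms(3) by auto
  qed
  show ?thesis
    using glued_imp_successor[OF assms(1)] *[of i j] *[of j i] unfolding symclp_def by blast
qed

lemma symclp_sim_gen: "symclp sim_gen s t \<longleftrightarrow> matched s t"
proof
  show "symclp sim_gen s t \<Longrightarrow> matched s t"
    using sim_gen_imp_matched matched_sym by (auto simp: symclp_def)
  show "matched s t \<Longrightarrow> symclp sim_gen s t"
  proof (induction rule: matched.induct)
    case (here a i j m v)
    then show ?case by (rule sim_gen_here)
  next
    case (there k s t)
    then show ?case using sim_gen_SCons by (auto simp: symclp_def)
  qed
qed

lemma glued_index: "glued a i j \<Longrightarrow> a = 0 \<or> a = 1"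
  unfolding glued_def by blast

lemma on_side_single_neq:
  assumes "a = 0 \<or> a = 1" "on_side a [m]"
  shows "m \<notin> {0, 5}"
  using assms by (elim disjE) auto

lemma on_side_single_unique:
  assumes "a = 0 \<or> a = 1" "b = 0 \<or> b = 1" "on_side a [m]" "on_side b [m]"
  shows "a = b"
  using assms by (elim disjE) auto

text \<open>A matched word contains a letter outside \<open>{0, 5}\<close> after its first letter. This is what
  prevents a second application of a generator at a later place.\<close>

lemma matched_stl: "matched s t \<Longrightarrow> stl s \<notin> streams {0, 5}"
proof (induction rule: matched.induct)
  case (here a i j m v)
  then show ?case using on_side_single_neq[OF glued_index[OF here(1)] here(2)] by (simp add: streams_Stream)
next
  case (there k s t)
  then show ?case using streams_stl by auto
qed

text \<open>The place of a generator and its kind are determined by the last letter outside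
  \<open>{0, 5}\<close>, and for a given kind each letter has at most one glued partner.\<close>

lemma matched_right_unique:
  assumes "matched s t" "matched s t'"
  shows "t = t'"
  using assms
proof (induction arbitrary: t' rule: matched.induct)
  case (here a i j m v)
  from here(4) show ?case
  proof (rule matched_SConsE)
    fix a' j' m' v'
    assume "glued a' i j'" "on_side a' [m']" "m ## v = m' ## v'" "t' = j' ## m' ## v'"
    moreover from this have "a' = a"
      using on_side_single_unique glued_index \<open>glued a i j\<close> \<open>on_side a [m]\<close>
      by (metis stream.inject)
    ultimately show ?thesis
      using glued_right_unique \<open>glued a i j\<close> by blast
  next
    fix t'' assume "matched (m ## v) t''"
    then show ?thesis using matched_stl[of "m ## v" t''] here(3) by simp
  qed
next
  case (there k s t)
  from there(4) show ?case
  proof (rule matched_SConsE)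
    fix a' j' m' v' assume "v' \<in> streams {0, 5}" "s = m' ## v'"
    then show ?thesis using matched_stl[OF there(2)] by simp
  next
    fix t'' assume "matched s t''" "t' = k ## t''"
    then show ?thesis using there(3) by simp
  qed
qed

text \<open>Since the symmetric closure is a partial matching, closing it under transitivity
  adds only the diagonal.\<close>

lemma sim_iff: "sim s t \<longleftrightarrow> s = t \<or> matched s t"
proof -
  have r: "symclp sim_gen = matched" using symclp_sim_gen by blast
  have "s = t \<or> matched s t" if "matched\<^sup>*\<^sup>* s t"
    using that
  proof (induction rule: rtranclp_induct)
    case (step t u)
    then show ?case using matched_sym matched_right_unique by metis
  qed simp
  then show ?thesis
    unfolding sim_def equivclp_def r by auto
qed

lemma glued_irrefl: "\<not> glued a k k"
  by (auto simp: glued_def doubleton_eq_iff)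

lemma matched_SCons_same:
  assumes "k \<in> X"
  shows "matched (k ## s) (k ## t) \<longleftrightarrow> matched s t"
proof
  assume "matched (k ## s) (k ## t)"
  then show "matched s t"
  proof (rule matched_SConsE)
    fix a l m v assume "glued a k l" "k ## t = l ## m ## v"
    then show "matched s t" using glued_irrefl[of a k] by simp
  qed simp
qed (rule matched.there[OF assms])

lemma matched_SCons_diff:
  assumes "k \<noteq> l"
  shows "matched (k ## s) (l ## t) \<longleftrightarrow>
    s = t \<and> (\<exists>a m v. glued a k l \<and> on_side a [m] \<and> v \<in> streams {0, 5} \<and> s = m ## v)"
  (is "_ \<longleftrightarrow> ?R")
proof
  assume "matched (k ## s) (l ## t)"
  then show ?R
  proof (rule matched_SConsE)
    fix a l' m v assume "glued a k l'" "on_side a [m]" "v \<in> streams {0, 5}" "s = m ## v" "l ## t = l' ## m ## v"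
    then show ?R by blast
  next
    fix t' assume "l ## t = k ## t'"
    then show ?R using assms by simp
  qed
next
  assume ?R
  then show "matched (k ## s) (l ## t)" using matched.here by blast
qed

lemma on_side_2_iff: "on_side 2 w \<longleftrightarrow> set w \<subseteq> {0, 5}"
  by (induction w) auto

lemma streams_shift_iff: "u @- x \<in> streams A \<longleftrightarrow> set u \<subseteq> A \<and> x \<in> streams A"
  by (induction u) (auto simp: streams_Stream)

text \<open>Cutting off a sequence that stays on a glued face gives a word of the form
  \<open>on_side\<close>, and conversely such a word can be continued by zeros. Only the empty word needs a letter
  3 or 1 in front of the zeros.\<close>

lemma on_side_iff_extension:
  assumes "glued a k l"
  shows "on_side a u \<longleftrightarrow> (\<exists>x\<in>streams X. \<exists>m v. on_side a [m] \<and> v \<in> streams {0, 5} \<and> u @- x = m ## v)"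
proof
  assume u: "on_side a u"
  have c: "sconst 0 \<in> streams X" "sconst 0 \<in> streams {0, 5 :: nat}"
    by (simp_all add: streams_iff_sset X_def)
  show "\<exists>x\<in>streams X. \<exists>m v. on_side a [m] \<and> v \<in> streams {0, 5} \<and> u @- x = m ## v"
  proof (cases u)
    case Nil
    let ?m = "if a = 0 then 3 else 1 :: nat"
    have "on_side a [?m]" "?m \<in> X"
      using glued_index[OF assms] by (auto simp: X_def)
    moreover have "?m ## sconst 0 \<in> streams X"
      using c \<open>?m \<in> X\<close> by (simp add: streams_Stream)
    ultimately show ?thesis using Nil c(2) by (metis shift.simps(1))
  next
    case (Cons m u')
    have "on_side a [m]" "u' @- sconst 0 \<in> streams {0, 5}"
      using u Cons c by (auto simp: on_side_2_iff streams_shift_iff)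
    then show ?thesis using c(1) Cons by (metis shift.simps(2))
  qed
next
  assume "\<exists>x\<in>streams X. \<exists>m v. on_side a [m] \<and> v \<in> streams {0, 5} \<and> u @- x = m ## v"
  then obtain x m v where *: "on_side a [m]" "v \<in> streams {0, 5}" "u @- x = m ## v" by blast
  show "on_side a u"
  proof (cases u)
    case (Cons m' u')
    then have "m' = m" "u' @- x = v" using *(3) by auto
    then have "set u' \<subseteq> {0, 5}" using *(2) by (auto simp: streams_shift_iff)
    then show ?thesis using *(1) Cons \<open>m' = m\<close> by (simp add: on_side_2_iff)
  qed simp
qed

lemma shift_eq_imp_eq: "length u = length w \<Longrightarrow> u @- x = w @- y \<Longrightarrow> u = w \<and> x = y"
  by (induction u w rule: list_induct2) auto

lemma matched_extension_iff_linked: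
  assumes "u \<in> lists X" "w \<in> lists X" "length u = length w" "u \<noteq> w"
  shows "(\<exists>x\<in>streams X. \<exists>y\<in>streams X. matched (u @- x) (w @- y)) \<longleftrightarrow> linked u w"
  using assms(3,1,2,4)
proof (induction u w rule: list_induct2)
  case (Cons k u l w)
  show ?case
  proof (cases "k = l")
    case True
    then show ?thesis using Cons by (simp add: matched_SCons_same)
  next
    case False
    have "(\<exists>x\<in>streams X. \<exists>y\<in>streams X. matched ((k # u) @- x) ((l # w) @- y)) \<longleftrightarrow>
        (\<exists>x\<in>streams X. \<exists>y\<in>streams X. u @- x = w @- y \<and>
          (\<exists>a m v. glued a k l \<and> on_side a [m] \<and> v \<in> streams {0, 5} \<and> u @- x = m ## v))"
      unfolding shift.simps matched_SCons_diff[OF False] ..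
    also have "\<dots> \<longleftrightarrow> u = w \<and> (\<exists>a. glued a k l \<and>
          (\<exists>x\<in>streams X. \<exists>m v. on_side a [m] \<and> v \<in> streams {0, 5} \<and> u @- x = m ## v))"
      using shift_eq_imp_eq[OF Cons.hyps] by blast
    also have "\<dots> \<longleftrightarrow> linked (k # u) (l # w)"
      using False on_side_iff_extension unfolding linked.simps by (metis (no_types, lifting))
    finally show ?thesis .
  qed
qed simp

section \<open>The isomorphism\<close>

lemma doubleton_mem_iff: "{a, b} \<in> {{x, y} | x y. P x y} \<longleftrightarrow> P a b \<or> P b a"
  by (auto simp: doubleton_eq_iff)

theorem theorem4p7:
  fixes T0 c :: region and n :: nat
  assumes "nondegenerate_triangle T0"
    and "c \<in> children T0"
    and "n \<ge> 1"
  shows "graph_isomorphism (Phi T0 c n) (offspring_graph T0 n) (word_graph n)"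
proof -
  obtain f where f: "nondeg f" "T0 = hull_of f" "c = hull_of (child 0 f)"
    using triangle_with_first_child[OF assms(1,2)] by blast
  let ?t = "\<lambda>w. hull_of (descendant f w)"
  have off: "offspring T0 n = ?t ` words n"
    using offspring_hull_of[OF f(1)] f(2) by simp
  have Phi: "Phi T0 c n (?t w) = w" if "w \<in> words n" for w
    using Phi_descendant[OF f(1), of w "n - 1"] that assms(3) f(2,3) by simp
  have "bij_betw (Phi T0 c n) (offspring T0 n) (words n)"
    unfolding off by (rule bij_betwI[of _ _ _ ?t]) (auto simp: Phi)
  moreover have "{s, t} \<in> snd (offspring_graph T0 n) \<longleftrightarrow> {Phi T0 c n s, Phi T0 c n t} \<in> snd (word_graph n)"
    if st: "s \<in> offspring T0 n" "t \<in> offspring T0 n" for s t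
  proof -
    obtain u w where uw: "u \<in> words n" "w \<in> words n" "s = ?t u" "t = ?t w"
      using st off by auto
    have edge: "u \<noteq> w \<and> (\<exists>x\<in>Sigma_words. \<exists>y\<in>Sigma_words. sim (w @- x) (u @- y)) \<longleftrightarrow> linked u w"
      if "u \<in> words n" "w \<in> words n" for u w
    proof (cases "u = w")
      case False
      have "sim (w @- x) (u @- y) \<longleftrightarrow> matched (u @- y) (w @- x)" for x y
      proof -
        have "w @- x \<noteq> u @- y"
          using shift_eq_imp_eq[of w u x y] False that by (auto simp: in_words_iff)
        then show ?thesis using sim_iff matched_sym by blast
      qed
      then have "(\<exists>x\<in>Sigma_words. \<exists>y\<in>Sigma_words. sim (w @- x) (u @- y)) \<longleftrightarrow> linked u w"
        using matched_extension_iff_linked[of u w] False that by (auto simp: in_words_iff)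
      then show ?thesis using False by simp
    qed (use linked_imp_neq in auto)
    have "adjacent s t \<longleftrightarrow> linked u w" "adjacent t s \<longleftrightarrow> linked w u"
      unfolding uw(3,4) using adjacent_iff_linked[OF f(1)] uw(1,2) by blast+
    moreover have "adjacent s t \<longleftrightarrow> adjacent t s"
      by (auto simp: adjacent_def)
    moreover have "{s, t} \<in> snd (offspring_graph T0 n) \<longleftrightarrow> adjacent s t \<or> adjacent t s"
      unfolding offspring_graph_def snd_conv doubleton_mem_iff using st by blast
    moreover have "{u, w} \<in> snd (word_graph n) \<longleftrightarrow> linked u w \<or> linked w u"
      unfolding word_graph_def snd_conv doubleton_mem_iff
      using edge[OF uw(1,2)] edge[OF uw(2,1)] uw(1,2) by blast
    moreover have "Phi T0 c n s = u" "Phi T0 c n t = w"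
      using Phi uw by simp_all
    ultimately show ?thesis by simp
  qed
  ultimately show ?thesis
    unfolding graph_isomorphism_def by (simp add: offspring_graph_def word_graph_def)
qed

end
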